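(* Let $R\subseteq T$ be rings forming a regular conductor square with conductor $C$, and set $A=R/C$, $B=T/C$. Assume that the square is non-trivial (i.e. $R\neq T$) and that $T$ is flat as an $R$-module. Then $B$ is not faithfully flat over $A$, and $C$ is not finitely generated over $R$.
   Context: All rings are commutative with identity. A conductor square consists of a ring $T$, a subring $R\subseteq T$ such that $R$ and $T$ have a common non-zero ideal, the largest common ideal $C$ of $R$ and $T$ (called the conductor of $T$ into $R$), and the rings $A=R/C$ and $B=T/C$, together with the inclusions $R\hookrightarrow T$, $A\hookrightarrow B$ and the projections $\eta_2\colon R\twoheadrightarrow A$, $\eta_1\colon T\twoheadrightarrow B$; equivalently, $R$ is the pullback $\{(a,t)\in A\times T\mid a=\eta_1(t)\text{ in }B\}$ and $C=\operatorname{Ker}(\eta_1)=\operatorname{Ker}(\eta_2)$ is the largest common ideal. The square is regular if $C$ contains a non-zero-divisor of $T$. It is trivial if the equivalent conditions $R=T$, $C=R$, $C=T$, $A=0$, $B=0$, $A=B$ hold. *)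

theory Defs
  imports "HOL-Algebra.Algebra"
begin

section \<open>Tensor products, flatness and faithful flatness\<close>

definition mod_hom :: "('a, 'r) ring_scheme \<Rightarrow> ('a, 'b, 'm) module_scheme
    \<Rightarrow> ('a, 'c, 'n) module_scheme \<Rightarrow> ('b \<Rightarrow> 'c) set"
  where "mod_hom R M N = {h \<in> hom (add_monoid M) (add_monoid N).
    \<forall>r\<in>carrier R. \<forall>x\<in>carrier M. h (r \<odot>\<^bsub>M\<^esub> x) = r \<odot>\<^bsub>N\<^esub> h x}"

definition tensor_relators :: "('a, 'r) ring_scheme \<Rightarrow> ('a, 'b, 'm) module_scheme
    \<Rightarrow> ('a, 'c, 'n) module_scheme \<Rightarrow> ('b \<times> 'c \<Rightarrow>\<^sub>0 int) set"
  where "tensor_relators R N M =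
    {frag_of (x \<oplus>\<^bsub>N\<^esub> x', y) - frag_of (x, y) - frag_of (x', y) | x x' y.
       x \<in> carrier N \<and> x' \<in> carrier N \<and> y \<in> carrier M} \<union>
    {frag_of (x, y \<oplus>\<^bsub>M\<^esub> y') - frag_of (x, y) - frag_of (x, y') | x y y'.
       x \<in> carrier N \<and> y \<in> carrier M \<and> y' \<in> carrier M} \<union>
    {frag_of (r \<odot>\<^bsub>N\<^esub> x, y) - frag_of (x, r \<odot>\<^bsub>M\<^esub> y) | r x y.
       r \<in> carrier R \<and> x \<in> carrier N \<and> y \<in> carrier M}"

definition tensor_subgroup :: "('a, 'r) ring_scheme \<Rightarrow> ('a, 'b, 'm) module_scheme
    \<Rightarrow> ('a, 'c, 'n) module_scheme \<Rightarrow> ('b \<times> 'c \<Rightarrow>\<^sub>0 int) set"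
  where "tensor_subgroup R N M =
    generate (free_Abelian_group (carrier N \<times> carrier M)) (tensor_relators R N M)"

text \<open>The underlying abelian group of the tensor product of \<open>N\<close> and \<open>M\<close> over \<open>R\<close>, written
  multiplicatively. Its scalar multiplication is not needed to speak about exactness.\<close>

definition tensor_group :: "('a, 'r) ring_scheme \<Rightarrow> ('a, 'b, 'm) module_scheme
    \<Rightarrow> ('a, 'c, 'n) module_scheme \<Rightarrow> ('b \<times> 'c \<Rightarrow>\<^sub>0 int) set monoid"
  where "tensor_group R N M =
    free_Abelian_group (carrier N \<times> carrier M) Mod tensor_subgroup R N M"

definition frag_map_fst :: "('b \<Rightarrow> 'd) \<Rightarrow> ('b \<times> 'c \<Rightarrow>\<^sub>0 int) \<Rightarrow> ('d \<times> 'c \<Rightarrow>\<^sub>0 int)"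
  where "frag_map_fst f = frag_extend (\<lambda>(x, y). frag_of (f x, y))"

text \<open>The homomorphism from \<open>tensor_group R N M\<close> to \<open>tensor_group R N' M\<close> induced by \<open>f\<close> on the
  first factor and by the identity on \<open>M\<close>.\<close>

definition tensor_map :: "('a, 'r) ring_scheme \<Rightarrow> ('a, 'd, 'm) module_scheme
    \<Rightarrow> ('a, 'c, 'n) module_scheme \<Rightarrow> ('b \<Rightarrow> 'd)
    \<Rightarrow> ('b \<times> 'c \<Rightarrow>\<^sub>0 int) set \<Rightarrow> ('d \<times> 'c \<Rightarrow>\<^sub>0 int) set"
  where "tensor_map R N' M f Z = the_elem ((\<lambda>z.
    r_coset (free_Abelian_group (carrier N' \<times> carrier M)) (tensor_subgroup R N' M)
      (frag_map_fst f z)) ` Z)"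

definition exact_pair :: "('b, 'k) monoid_scheme \<Rightarrow> ('c, 'm) monoid_scheme \<Rightarrow> ('d, 'n) monoid_scheme
    \<Rightarrow> ('b \<Rightarrow> 'c) \<Rightarrow> ('c \<Rightarrow> 'd) \<Rightarrow> bool"
  where "exact_pair G H K f g \<longleftrightarrow> f ` carrier G = kernel H K g"

text \<open>\<open>M\<close> is flat if tensoring with \<open>M\<close> turns exact sequences \<open>N1 \<rightarrow> N2 \<rightarrow> N3\<close> of \<open>R\<close>-modules into
  exact sequences, and faithfully flat if a sequence is exact precisely when the tensored sequence
  is. A definition in HOL cannot quantify over all types, so the test modules have elements in one
  type, \<^typ>\<open>'a list set\<close> for a ring with elements in \<^typ>\<open>'a\<close>. This type contains every
  subquotient of a free module of finite rank (an equivalence class of tuples), hence up to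
  isomorphism all finitely generated modules and their submodules. That suffices to test both
  properties: an injection that does not stay injective under the tensor product can be cut down to
  one between finitely generated modules, and, for \<open>M\<close> flat, a non-exact sequence with exact tensored
  sequence yields a non-zero cyclic module with zero tensor product with \<open>M\<close>.\<close>

type_synonym 'a test_module = "('a, 'a list set) module"

definition flat_module :: "('a, 'r) ring_scheme \<Rightarrow> ('a, 'c, 'm) module_scheme \<Rightarrow> bool"
  where "flat_module R M \<longleftrightarrow> module R M \<and>
    (\<forall>(N1 :: 'a test_module) (N2 :: 'a test_module) (N3 :: 'a test_module).
      \<forall>f \<in> mod_hom R N1 N2. \<forall>g \<in> mod_hom R N2 N3.
      module R N1 \<longrightarrow> module R N2 \<longrightarrow> module R N3 \<longrightarrow>
      exact_pair (add_monoid N1) (add_monoid N2) (add_monoid N3) f g \<longrightarrow>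
      exact_pair (tensor_group R N1 M) (tensor_group R N2 M) (tensor_group R N3 M)
        (tensor_map R N2 M f) (tensor_map R N3 M g))"

definition faithfully_flat_module :: "('a, 'r) ring_scheme \<Rightarrow> ('a, 'c, 'm) module_scheme \<Rightarrow> bool"
  where "faithfully_flat_module R M \<longleftrightarrow> module R M \<and>
    (\<forall>(N1 :: 'a test_module) (N2 :: 'a test_module) (N3 :: 'a test_module).
      \<forall>f \<in> mod_hom R N1 N2. \<forall>g \<in> mod_hom R N2 N3.
      module R N1 \<longrightarrow> module R N2 \<longrightarrow> module R N3 \<longrightarrow>
      (exact_pair (add_monoid N1) (add_monoid N2) (add_monoid N3) f g \<longleftrightarrow>
      exact_pair (tensor_group R N1 M) (tensor_group R N2 M) (tensor_group R N3 M)
        (tensor_map R N2 M f) (tensor_map R N3 M g)))"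

text \<open>A ring regarded as a module over any of its subrings.\<close>

definition ring_module :: "('a, 'r) ring_scheme \<Rightarrow> ('a, 'a) module"
  where "ring_module T = \<lparr>carrier = carrier T, monoid.mult = monoid.mult T, one = one T,
    ring.zero = ring.zero T, ring.add = ring.add T, smult = monoid.mult T\<rparr>"


section \<open>Conductor squares\<close>

text \<open>The rings \<open>A = R/C\<close> and \<open>B = T/C\<close> of the square are \<open>T\<lparr>carrier := R\<rparr> Quot C\<close> and \<open>T Quot C\<close>. A
  residue class in \<open>A\<close> is the same set as its image in \<open>B\<close>, so \<open>A\<close> is literally a subring of \<open>B\<close>
  (see \<open>quotient_subset\<close> and \<open>quotient_module\<close> below).\<close>

locale conductor_square = cring T + subcring R T for R and T (structure) +
  fixes C
  assumes ideal_T: "ideal C T"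
    and ideal_R: "ideal C (T\<lparr>carrier := R\<rparr>)"
    and largest: "\<And>I. ideal I T \<Longrightarrow> ideal I (T\<lparr>carrier := R\<rparr>) \<Longrightarrow> I \<subseteq> C"
    and non_zero: "C \<noteq> {\<zero>}"

locale regular_conductor_square = conductor_square +
  assumes regular: "\<exists>c\<in>C. \<forall>t\<in>carrier T. c \<otimes> t = \<zero> \<longrightarrow> t = \<zero>"


section \<open>Well-definedness\<close>

lemma tensor_relators_subset:
  assumes "module R N" "module R M"
  shows "tensor_relators R N M \<subseteq> carrier (free_Abelian_group (carrier N \<times> carrier M))"
proof -
  interpret N: module R N by fact
  interpret M: module R M by fact
  have frag: "frag_of z \<in> carrier (free_Abelian_group (carrier N \<times> carrier M))"
    if "z \<in> carrier N \<times> carrier M" for z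
    using that by simp
  have *: "u - v \<in> carrier (free_Abelian_group (carrier N \<times> carrier M))"
    if "u \<in> carrier (free_Abelian_group (carrier N \<times> carrier M))"
      "v \<in> carrier (free_Abelian_group (carrier N \<times> carrier M))" for u v
    using that keys_diff[of u v] by auto
  show ?thesis
    unfolding tensor_relators_def
    by (intro Un_least subsetI; clarify; intro *) (auto intro!: frag)
qed

lemma tensor_subgroup_normal:
  assumes "module R N" "module R M"
  shows "tensor_subgroup R N M \<lhd> free_Abelian_group (carrier N \<times> carrier M)"
  unfolding tensor_subgroup_def
  by (intro comm_group.normal_iff_subgroup[THEN iffD2] abelian_free_Abelian_group
      group.generate_is_subgroup group_free_Abelian_group tensor_relators_subset assms)

lemma comm_group_tensor_group:
  assumes "module R N" "module R M"
  shows "comm_group (tensor_group R N M)"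
  unfolding tensor_group_def
  by (intro comm_group.abelian_FactGroup abelian_free_Abelian_group
      normal_imp_subgroup tensor_subgroup_normal assms)

lemma frag_map_fst_hom:
  assumes "f \<in> mod_hom R N N'"
  shows "frag_map_fst f \<in> hom (free_Abelian_group (carrier N \<times> carrier M))
    (free_Abelian_group (carrier N' \<times> carrier M))"
proof (rule homI)
  fix z assume z: "z \<in> carrier (free_Abelian_group (carrier N \<times> carrier M))"
  have f: "\<And>x. x \<in> carrier N \<Longrightarrow> f x \<in> carrier N'"
    using assms by (auto simp: mod_hom_def hom_def)
  have "Poly_Mapping.keys (frag_map_fst f z)
      \<subseteq> (\<Union>x\<in>Poly_Mapping.keys z. Poly_Mapping.keys (case x of (x, y) \<Rightarrow> frag_of (f x, y)))"
    unfolding frag_map_fst_def by (rule keys_frag_extend)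
  also have "\<dots> \<subseteq> carrier N' \<times> carrier M"
    using z f by (auto split: prod.splits)
  finally show "frag_map_fst f z \<in> carrier (free_Abelian_group (carrier N' \<times> carrier M))"
    by simp
qed (simp add: frag_map_fst_def frag_extend_add)

lemma frag_map_fst_subgroup:
  assumes N: "module R N" and N': "module R N'" and M: "module R M"
    and f: "f \<in> mod_hom R N N'" and z: "z \<in> tensor_subgroup R N M"
  shows "frag_map_fst f z \<in> tensor_subgroup R N' M"
proof -
  let ?F = "free_Abelian_group (carrier N \<times> carrier M)"
  let ?F' = "free_Abelian_group (carrier N' \<times> carrier M)"
  interpret h: group_hom ?F ?F' "frag_map_fst f"
    by (intro group_hom.intro group_hom_axioms.intro group_free_Abelian_group frag_map_fst_hom[OF f])
  have fc: "\<And>x. x \<in> carrier N \<Longrightarrow> f x \<in> carrier N'"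
    and fa: "\<And>x x'. x \<in> carrier N \<Longrightarrow> x' \<in> carrier N \<Longrightarrow> f (x \<oplus>\<^bsub>N\<^esub> x') = f x \<oplus>\<^bsub>N'\<^esub> f x'"
    and fs: "\<And>r x. r \<in> carrier R \<Longrightarrow> x \<in> carrier N \<Longrightarrow> f (r \<odot>\<^bsub>N\<^esub> x) = r \<odot>\<^bsub>N'\<^esub> f x"
    using f by (auto simp: mod_hom_def hom_def)
  have "frag_map_fst f ` tensor_relators R N M \<subseteq> tensor_relators R N' M"
    unfolding tensor_relators_def image_Un
    by (intro Un_mono) (force simp: frag_map_fst_def frag_extend_diff fa fs fc)+
  moreover have "generate ?F' (frag_map_fst f ` tensor_relators R N M)
      = frag_map_fst f ` tensor_subgroup R N M"
    unfolding tensor_subgroup_def by (rule h.generate_img[OF tensor_relators_subset[OF N M]])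
  ultimately show ?thesis
    using z group.mono_generate[OF group_free_Abelian_group] unfolding tensor_subgroup_def by blast
qed

lemma tensor_map_coset:
  assumes N: "module R N" and N': "module R N'" and M: "module R M"
    and f: "f \<in> mod_hom R N N'"
    and z: "z \<in> carrier (free_Abelian_group (carrier N \<times> carrier M))"
  shows "tensor_map R N' M f
      (r_coset (free_Abelian_group (carrier N \<times> carrier M)) (tensor_subgroup R N M) z)
    = r_coset (free_Abelian_group (carrier N' \<times> carrier M)) (tensor_subgroup R N' M)
        (frag_map_fst f z)"
proof -
  let ?F = "free_Abelian_group (carrier N \<times> carrier M)"
  let ?F' = "free_Abelian_group (carrier N' \<times> carrier M)"
  let ?H = "tensor_subgroup R N M" and ?H' = "tensor_subgroup R N' M"
  have H: "subgroup ?H ?F" "subgroup ?H' ?F'"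
    using tensor_subgroup_normal normal_imp_subgroup N N' M by blast+
  interpret F': group ?F' by simp
  have "r_coset ?F' ?H' (frag_map_fst f w) = r_coset ?F' ?H' (frag_map_fst f z)"
    if w: "w \<in> r_coset ?F ?H z" for w
  proof -
    obtain h where h: "h \<in> ?H" "w = h + z"
      using w by (auto simp: r_coset_def)
    have "frag_map_fst f w = frag_map_fst f h + frag_map_fst f z"
      by (simp add: h frag_map_fst_def frag_extend_add)
    then have "frag_map_fst f w \<in> r_coset ?F' ?H' (frag_map_fst f z)"
      using frag_map_fst_subgroup[OF N N' M f h(1)] by (auto simp: r_coset_def)
    then show ?thesis
      using F'.repr_independence[OF _ _ H(2)] hom_in_carrier[OF frag_map_fst_hom[OF f] z] by metis
  qed
  moreover have "z \<in> r_coset ?F ?H z"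
    using group.rcos_self[OF group_free_Abelian_group z H(1)] .
  ultimately show ?thesis
    unfolding tensor_map_def by (intro the_elem_image_unique) blast+
qed

lemma tensor_map_hom:
  assumes N: "module R N" and N': "module R N'" and M: "module R M"
    and f: "f \<in> mod_hom R N N'"
  shows "tensor_map R N' M f \<in> hom (tensor_group R N M) (tensor_group R N' M)"
proof -
  note n = tensor_subgroup_normal[OF N M] tensor_subgroup_normal[OF N' M]
  note h = frag_map_fst_hom[OF f, where M = M]
  show ?thesis
  proof (rule homI)
    fix a assume "a \<in> carrier (tensor_group R N M)"
    then obtain z where z: "z \<in> carrier (free_Abelian_group (carrier N \<times> carrier M))"
      and a: "a = r_coset (free_Abelian_group (carrier N \<times> carrier M)) (tensor_subgroup R N M) z"
      unfolding tensor_group_def carrier_FactGroup by blast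
    show "tensor_map R N' M f a \<in> carrier (tensor_group R N' M)"
      unfolding a tensor_map_coset[OF N N' M f z] tensor_group_def carrier_FactGroup
      using hom_in_carrier[OF h z] by blast
    fix b assume "b \<in> carrier (tensor_group R N M)"
    then obtain w where w: "w \<in> carrier (free_Abelian_group (carrier N \<times> carrier M))"
      and b: "b = r_coset (free_Abelian_group (carrier N \<times> carrier M)) (tensor_subgroup R N M) w"
      unfolding tensor_group_def carrier_FactGroup by blast
    note zw = monoid.m_closed[OF group.is_monoid[OF group_free_Abelian_group] z w]
    show "tensor_map R N' M f (a \<otimes>\<^bsub>tensor_group R N M\<^esub> b)
        = tensor_map R N' M f a \<otimes>\<^bsub>tensor_group R N' M\<^esub> tensor_map R N' M f b"
      unfolding a b tensor_group_def mult_FactGroup normal.rcos_sum[OF n(1) z w]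
        tensor_map_coset[OF N N' M f z] tensor_map_coset[OF N N' M f w]
        tensor_map_coset[OF N N' M f zw] hom_mult[OF h z w]
      by (rule normal.rcos_sum[OF n(2) hom_in_carrier[OF h z] hom_in_carrier[OF h w], symmetric])
  qed
qed

lemma ring_module_simps [simp]:
  "carrier (ring_module T) = carrier T" "ring.add (ring_module T) = ring.add T"
  "ring.zero (ring_module T) = ring.zero T" "smult (ring_module T) = monoid.mult T"
  by (simp_all add: ring_module_def)

lemma module_ring_module:
  assumes S: "cring S" and T: "cring T" and sub: "carrier S \<subseteq> carrier T"
    and eqs: "one S = one T"
      "\<And>x y. x \<in> carrier S \<Longrightarrow> y \<in> carrier S \<Longrightarrow> x \<oplus>\<^bsub>S\<^esub> y = x \<oplus>\<^bsub>T\<^esub> y"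
      "\<And>x y. x \<in> carrier S \<Longrightarrow> y \<in> carrier S \<Longrightarrow> x \<otimes>\<^bsub>S\<^esub> y = x \<otimes>\<^bsub>T\<^esub> y"
  shows "module S (ring_module T)"
proof -
  interpret T: cring T by fact
  have "abelian_group (ring_module T)"
  proof (rule abelian_groupI)
    fix x assume "x \<in> carrier (ring_module T)"
    then show "\<exists>y\<in>carrier (ring_module T). y \<oplus>\<^bsub>ring_module T\<^esub> x = \<zero>\<^bsub>ring_module T\<^esub>"
      by (intro bexI[of _ "\<ominus>\<^bsub>T\<^esub> x"]) (simp_all add: T.l_neg)
  qed (simp_all add: T.a_ac)
  then show ?thesis
    by (rule moduleI[OF S]) (use sub in \<open>auto simp: eqs subset_iff T.l_distr T.r_distr T.m_assoc\<close>)
qed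

context conductor_square
begin

lemma cring_R: "cring (T\<lparr>carrier := R\<rparr>)"
  using subcring_iff[OF subset] subcring_axioms by blast

lemma T_module: "module (T\<lparr>carrier := R\<rparr>) (ring_module T)"
  by (rule module_ring_module[OF cring_R is_cring]) (use subset in auto)

lemma C_subset: "C \<subseteq> R"
  using additive_subgroup.a_subset[OF ideal.axioms(1)[OF ideal_R]] by simp

lemma quotient_coset: "a_r_coset (T\<lparr>carrier := R\<rparr>) C = a_r_coset T C"
  by (simp add: a_r_coset_def r_coset_def fun_eq_iff)

lemma quotient_subset: "carrier (T\<lparr>carrier := R\<rparr> Quot C) \<subseteq> carrier (T Quot C)"
  using subset by (auto simp: FactRing_def A_RCOSETS_def' a_r_coset_def r_coset_def)

lemma quotient_module: "module (T\<lparr>carrier := R\<rparr> Quot C) (ring_module (T Quot C))"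
proof (rule module_ring_module)
  show "cring (T\<lparr>carrier := R\<rparr> Quot C)" "cring (T Quot C)"
    using ideal.quotient_is_cring[OF ideal_R cring_R]
      ideal.quotient_is_cring[OF ideal_T is_cring] by auto
qed (use quotient_subset in \<open>simp_all add: FactRing_def rcoset_mult_def quotient_coset set_add_def set_mult_def\<close>)

end

end

theory Submission
  imports Defs
begin

text \<open>Let \<open>c \<in> C\<close> be a non-zero-divisor of \<open>T\<close>, let \<open>t \<in> T - R\<close>, and let \<open>I = {r \<in> R. r t \<in> R}\<close>.
  Multiplication by \<open>c t \<in> C\<close> induces an injection \<open>R/I \<rightarrow> R/cR\<close>. Tensored with \<open>T\<close> it maps
  \<open>1 \<otimes> 1\<close> to \<open>ct \<otimes> 1 = 1 \<otimes> ct = c \<otimes> t = 0\<close>, so flatness makes \<open>1 \<otimes> 1\<close> vanish in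
  \<open>R/I \<otimes> T = T/IT\<close>, that is \<open>IT = T\<close>, although \<open>I \<noteq> R\<close>. Modulo \<open>C\<close> this says that the non-zero
  \<open>A\<close>-module \<open>R/I\<close> becomes zero over \<open>B\<close>, so \<open>B\<close> is not faithfully flat. Moreover \<open>C = TC = ITC = IC\<close>, so if \<open>C\<close> were finitely
  generated, Nakayama's lemma would give \<open>i \<in> I\<close> with \<open>(1 - i) C = 0\<close>, and \<open>(1 - i) c = 0\<close>
  forces \<open>1 = i \<in> I\<close>.\<close>

section \<open>Nakayama's lemma\<close>

context cring
begin

text \<open>\<open>line_extension I a E\<close> is \<open>I a + E\<close>. The scalars form an ideal
  here instead of a subfield, so \<open>Span I ss\<close> is the product of \<open>I\<close> with
  the ideal generated by \<open>ss\<close>.\<close>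

lemma ideal_line_extension:
  assumes I: "ideal I R" and E: "ideal E R" and a: "a \<in> carrier R"
  shows "ideal (line_extension I a E) R"
proof -
  interpret I: ideal I R by fact
  interpret E: ideal E R by fact
  have l: "x \<otimes> u \<in> line_extension I a E" if u: "u \<in> line_extension I a E" and x: "x \<in> carrier R" for u x
  proof -
    obtain i e where ie: "i \<in> I" "e \<in> E" "u = i \<otimes> a \<oplus> e"
      using u by (auto simp: line_extension_mem_iff)
    then have "x \<otimes> u = (x \<otimes> i) \<otimes> a \<oplus> x \<otimes> e"
      using x a by (simp add: r_distr m_assoc I.Icarr E.Icarr)
    moreover have "x \<otimes> i \<in> I" "x \<otimes> e \<in> E"
      using ie x I.I_l_closed E.I_l_closed by auto
    ultimately show ?thesis
      unfolding line_extension_mem_iff by blast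
  qed
  have sub: "line_extension I a E \<subseteq> carrier R"
    using line_extension_in_carrier a I.a_subset E.a_subset by blast
  show ?thesis
  proof (rule idealI[OF ring_axioms])
    show "subgroup (line_extension I a E) (add_monoid R)"
    proof (rule add.subgroupI)
      show "line_extension I a E \<noteq> {}"
        using line_extension_mem_iff[of _ I a E] I.zero_closed E.zero_closed by blast
    next
      fix u assume u: "u \<in> line_extension I a E"
      have "\<ominus> u = (\<ominus> \<one>) \<otimes> u"
        using u sub by (auto simp: l_minus)
      then show "\<ominus> u \<in> line_extension I a E"
        using l[OF u, of "\<ominus> \<one>"] by simp
    next
      fix u v assume "u \<in> line_extension I a E" "v \<in> line_extension I a E"
      then obtain i e j f where ie: "i \<in> I" "e \<in> E" "u = i \<otimes> a \<oplus> e"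
        and jf: "j \<in> I" "f \<in> E" "v = j \<otimes> a \<oplus> f"
        by (auto simp: line_extension_mem_iff)
      then have "u \<oplus> v = (i \<oplus> j) \<otimes> a \<oplus> (e \<oplus> f)"
        using a by (simp add: l_distr I.Icarr E.Icarr a_ac)
      then show "u \<oplus> v \<in> line_extension I a E"
        using ie jf I.a_closed E.a_closed by (auto simp: line_extension_mem_iff)
    qed (use sub in simp)
    show "u \<otimes> x \<in> line_extension I a E" if "u \<in> line_extension I a E" "x \<in> carrier R" for u x
      using l[OF that] that sub m_comm by fastforce
  qed (rule l)
qed

text \<open>The colon ideal \<open>(E : i)\<close>. Because it is an ideal,
  \<open>i C \<subseteq> E\<close> need only be checked on generators of \<open>C\<close>.\<close>

lemma ideal_colon_element:
  assumes E: "ideal E R" and i: "i \<in> carrier R"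
  shows "ideal {x \<in> carrier R. i \<otimes> x \<in> E} R"
proof -
  interpret E: ideal E R by fact
  show ?thesis
  proof (rule idealI[OF ring_axioms])
    show "subgroup {x \<in> carrier R. i \<otimes> x \<in> E} (add_monoid R)"
    proof (rule add.subgroupI)
      show "{x \<in> carrier R. i \<otimes> x \<in> E} \<noteq> {}"
        using i E.zero_closed by (auto intro!: exI[of _ \<zero>])
    qed (use i E.a_closed E.a_inv_closed in \<open>auto simp: r_distr r_minus\<close>)
    show "x \<otimes> a \<in> {x \<in> carrier R. i \<otimes> x \<in> E}"
      if "a \<in> {x \<in> carrier R. i \<otimes> x \<in> E}" "x \<in> carrier R" for a x
      using that i E.I_l_closed[of "i \<otimes> a" x] by (simp add: m_lcomm)
    show "a \<otimes> x \<in> {x \<in> carrier R. i \<otimes> x \<in> E}"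
      if "a \<in> {x \<in> carrier R. i \<otimes> x \<in> E}" "x \<in> carrier R" for a x
      using that i E.I_r_closed[of "i \<otimes> a" x] by (simp add: m_assoc)
  qed
qed

lemma ideal_Span:
  assumes "ideal I R" "set ss \<subseteq> carrier R"
  shows "ideal (Span I ss) R"
  using assms(2) by (induction ss) (auto intro!: ideal_line_extension assms(1) zeroideal)

text \<open>Unlike over a field, \<open>s\<close> itself need not lie in \<open>Span I ss\<close>;
  only its multiples by \<open>I\<close> are certain to.\<close>

lemma smult_mem_Span:
  assumes I: "ideal I R" and "set ss \<subseteq> carrier R" "i \<in> I" "s \<in> set ss"
  shows "i \<otimes> s \<in> Span I ss"
  using assms(2,4)
proof (induction ss)
  case (Cons a ss)
  interpret I: ideal I R by fact
  interpret E: ideal "Span I ss" R using Cons.prems by (intro ideal_Span I) simp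
  show ?case
  proof (cases "s = a")
    case True
    have "i \<otimes> a = i \<otimes> a \<oplus> \<zero>" using Cons.prems assms(3) I.Icarr by simp
    then have "\<exists>k\<in>I. \<exists>v\<in>Span I ss. i \<otimes> a = k \<otimes> a \<oplus> v" using assms(3) E.zero_closed by blast
    then show ?thesis using True by (simp add: line_extension_mem_iff)
  next
    case False
    then have sS: "i \<otimes> s \<in> Span I ss" using Cons by auto
    have "i \<otimes> s = \<zero> \<otimes> a \<oplus> i \<otimes> s" using Cons.prems sS E.Icarr by simp
    then have "\<exists>k\<in>I. \<exists>v\<in>Span I ss. i \<otimes> s = k \<otimes> a \<oplus> v" using sS I.zero_closed by blast
    then show ?thesis by (simp add: line_extension_mem_iff)
  qed
qed simp

text \<open>Generators are removed one at a time, without determinants. The invariant is that some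
  factor \<open>\<one> \<ominus> j\<close> with \<open>j \<in> I\<close> sends \<open>M\<close> into
  the span of the remaining generators; when none are left, that span is
  \<open>{\<zero>}\<close>.\<close>

lemma Nakayama_Span_aux:
  assumes I: "ideal I R" and M: "M \<subseteq> carrier R"
    and "set ss \<subseteq> M" "j \<in> I" "\<And>x. x \<in> M \<Longrightarrow> (\<one> \<ominus> j) \<otimes> x \<in> Span I ss"
  shows "\<exists>i\<in>I. \<forall>x\<in>M. (\<one> \<ominus> i) \<otimes> x = \<zero>"
  using assms(3-5)
proof (induction ss arbitrary: j)
  case Nil
  then show ?case by auto
next
  case (Cons s ss)
  interpret I: ideal I R by fact
  have s: "s \<in> M" "s \<in> carrier R" and ss: "set ss \<subseteq> M" using Cons.prems(1) M by auto
  interpret E: ideal "Span I ss" R using ss M by (intro ideal_Span I) simp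
  note j = I.Icarr[OF Cons.prems(2)]
  have dec: "\<exists>k\<in>I. \<exists>v\<in>Span I ss. (\<one> \<ominus> j) \<otimes> x = k \<otimes> s \<oplus> v" if "x \<in> M" for x
    using Cons.prems(3)[OF that] by (simp add: line_extension_mem_iff)
  obtain k v where k: "k \<in> I" and v: "v \<in> Span I ss" and kv: "(\<one> \<ominus> j) \<otimes> s = k \<otimes> s \<oplus> v"
    using dec[OF s(1)] by blast
  \<comment> \<open>Rearranging \<open>kv\<close> gives \<open>?w \<otimes> s = v\<close>: the
    factor \<open>?w\<close> pushes the generator to be removed into the smaller span.\<close>
  let ?u = "\<one> \<ominus> j" and ?w = "\<one> \<ominus> j \<ominus> k"
  note kc = I.Icarr[OF k]
  have "?w \<otimes> s = ?u \<otimes> s \<ominus> k \<otimes> s" using s j kc by algebra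
  also have "\<dots> = v" unfolding kv using s kc E.Icarr[OF v] by algebra
  finally have ws: "?w \<otimes> s \<in> Span I ss" using v by simp
  \<comment> \<open>Solved from \<open>\<one> \<ominus> i = ?w \<otimes> ?u\<close>; every term of
    the expansion has a factor \<open>j\<close> or \<open>k\<close>, hence lies in
    \<open>I\<close>.\<close>
  define i where "i = j \<oplus> j \<oplus> k \<ominus> j \<otimes> j \<ominus> k \<otimes> j"
  have iI: "i \<in> I"
    unfolding i_def using Cons.prems(2) k j kc
    by (auto simp: a_minus_def intro!: I.a_closed I.a_inv_closed I.I_l_closed)
  have i: "\<one> \<ominus> i = ?w \<otimes> ?u" unfolding i_def using j kc by algebra
  show ?case
  proof (rule Cons.IH[OF ss iI])
    fix x assume x: "x \<in> M"
    obtain l w where l: "l \<in> I" and w: "w \<in> Span I ss" and lw: "?u \<otimes> x = l \<otimes> s \<oplus> w"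
      using dec[OF x] by blast
    have "(\<one> \<ominus> i) \<otimes> x = ?w \<otimes> (?u \<otimes> x)" unfolding i using x M j kc by (simp add: m_assoc subset_iff)
    also have "\<dots> = l \<otimes> (?w \<otimes> s) \<oplus> ?w \<otimes> w"
      unfolding lw using s j kc I.Icarr[OF l] E.Icarr[OF w] by algebra
    also have "\<dots> \<in> Span I ss"
      using j kc I.Icarr[OF l] by (intro E.a_closed E.I_l_closed[OF ws] E.I_l_closed[OF w]) auto
    finally show "(\<one> \<ominus> i) \<otimes> x \<in> Span I ss" .
  qed
qed

text \<open>The induction is started with \<open>j = \<zero>\<close>. When \<open>M\<close> is the
  ideal generated by \<open>ss\<close>, the inclusion assumed here says
  \<open>M = I M\<close>.\<close>

lemma Nakayama_Span:
  assumes I: "ideal I R" and M: "M \<subseteq> carrier R"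
    and "set ss \<subseteq> M" "M \<subseteq> Span I ss"
  shows "\<exists>i\<in>I. \<forall>x\<in>M. (\<one> \<ominus> i) \<otimes> x = \<zero>"
proof (rule Nakayama_Span_aux[OF I M assms(3)])
  interpret I: ideal I R by fact
  show "\<zero> \<in> I" by (rule I.zero_closed)
  show "(\<one> \<ominus> \<zero>) \<otimes> x \<in> Span I ss" if "x \<in> M" for x
    using that M subsetD[OF assms(4) that] by (auto simp: a_minus_def)
qed

end


section \<open>Relations in tensor products\<close>

context
  fixes R :: "('a, 'r) ring_scheme" and N :: "('a, 'b, 'm) module_scheme"
    and M :: "('a, 'c, 'n) module_scheme"
  assumes N: "module R N" and M: "module R M"
begin

lemma tensor_subgroup_subgroup:
  "subgroup (tensor_subgroup R N M) (free_Abelian_group (carrier N \<times> carrier M))"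
  using normal_imp_subgroup tensor_subgroup_normal N M by blast

lemma tensor_subgroup_closed:
  assumes "u \<in> tensor_subgroup R N M" "v \<in> tensor_subgroup R N M"
  shows "u + v \<in> tensor_subgroup R N M" "u - v \<in> tensor_subgroup R N M" "- u \<in> tensor_subgroup R N M"
proof -
  note S = tensor_subgroup_subgroup
  have k: "- w \<in> tensor_subgroup R N M" if "w \<in> tensor_subgroup R N M" for w
    using subgroup.m_inv_closed[OF S that] subgroup.mem_carrier[OF S that] by simp
  have a: "w + w' \<in> tensor_subgroup R N M"
    if "w \<in> tensor_subgroup R N M" "w' \<in> tensor_subgroup R N M" for w w'
    using subgroup.m_closed[OF S that] by simp
  show "u + v \<in> tensor_subgroup R N M" "- u \<in> tensor_subgroup R N M" using a k assms by auto
  show "u - v \<in> tensor_subgroup R N M" using a[OF assms(1) k[OF assms(2)]] by simp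
qed

lemma tensor_subgroup_relators: "tensor_relators R N M \<subseteq> tensor_subgroup R N M"
  unfolding tensor_subgroup_def by (auto intro: generate.incl)

text \<open>The additivity relator for the sum of zero and zero collapses to minus the generator in
  question.\<close>

lemma tensor_subgroup_zero_left:
  assumes y: "y \<in> carrier M"
  shows "frag_of (\<zero>\<^bsub>N\<^esub>, y) \<in> tensor_subgroup R N M"
proof -
  interpret N: module R N by fact
  have "frag_of (\<zero>\<^bsub>N\<^esub> \<oplus>\<^bsub>N\<^esub> \<zero>\<^bsub>N\<^esub>, y) - frag_of (\<zero>\<^bsub>N\<^esub>, y) - frag_of (\<zero>\<^bsub>N\<^esub>, y) \<in> tensor_relators R N M"
    using y unfolding tensor_relators_def by blast
  then have "- frag_of (\<zero>\<^bsub>N\<^esub>, y) \<in> tensor_subgroup R N M"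
    using tensor_subgroup_relators by auto
  from tensor_subgroup_closed(3)[OF this this] show ?thesis by simp
qed

lemma tensor_subgroup_add_right:
  assumes x: "x \<in> carrier N" "y \<in> carrier M" "y' \<in> carrier M"
    and H: "frag_of (x, y) \<in> tensor_subgroup R N M" "frag_of (x, y') \<in> tensor_subgroup R N M"
  shows "frag_of (x, y \<oplus>\<^bsub>M\<^esub> y') \<in> tensor_subgroup R N M"
proof -
  have "frag_of (x, y \<oplus>\<^bsub>M\<^esub> y') - frag_of (x, y) - frag_of (x, y') \<in> tensor_relators R N M"
    using x unfolding tensor_relators_def by blast
  then have "frag_of (x, y \<oplus>\<^bsub>M\<^esub> y') - frag_of (x, y) - frag_of (x, y') \<in> tensor_subgroup R N M"
    using tensor_subgroup_relators by blast
  from tensor_subgroup_closed(1)[OF tensor_subgroup_closed(1)[OF this H(2)] H(1)] show ?thesis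
    by simp
qed

lemma tensor_subgroup_smult_iff:
  assumes x: "r \<in> carrier R" "x \<in> carrier N" "y \<in> carrier M"
  shows "frag_of (r \<odot>\<^bsub>N\<^esub> x, y) \<in> tensor_subgroup R N M
    \<longleftrightarrow> frag_of (x, r \<odot>\<^bsub>M\<^esub> y) \<in> tensor_subgroup R N M"
proof -
  have "frag_of (r \<odot>\<^bsub>N\<^esub> x, y) - frag_of (x, r \<odot>\<^bsub>M\<^esub> y) \<in> tensor_relators R N M"
    using x unfolding tensor_relators_def by blast
  then have d: "frag_of (r \<odot>\<^bsub>N\<^esub> x, y) - frag_of (x, r \<odot>\<^bsub>M\<^esub> y) \<in> tensor_subgroup R N M"
    using tensor_subgroup_relators by blast
  show ?thesis
    using tensor_subgroup_closed(1)[OF d] tensor_subgroup_closed(2)[OF _ d] by force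
qed

text \<open>Pure tensors generate the tensor product, so it is zero as soon as they vanish. Being
  zero is expressed by the relations filling the whole free group.\<close>

lemma tensor_subgroup_eq_carrierI:
  assumes "\<And>x y. x \<in> carrier N \<Longrightarrow> y \<in> carrier M \<Longrightarrow> frag_of (x, y) \<in> tensor_subgroup R N M"
  shows "tensor_subgroup R N M = carrier (free_Abelian_group (carrier N \<times> carrier M))"
proof
  show "tensor_subgroup R N M \<subseteq> carrier (free_Abelian_group (carrier N \<times> carrier M))"
    by (rule subgroup.subset[OF tensor_subgroup_subgroup])
  show "carrier (free_Abelian_group (carrier N \<times> carrier M)) \<subseteq> tensor_subgroup R N M"
  proof
    fix z assume "z \<in> carrier (free_Abelian_group (carrier N \<times> carrier M))"
    then have "Poly_Mapping.keys z \<subseteq> carrier N \<times> carrier M" by simp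
    then show "z \<in> tensor_subgroup R N M"
      using subgroup.one_closed[OF tensor_subgroup_subgroup] assms tensor_subgroup_closed(2)
      by (induction z rule: frag_induction) auto
  qed
qed

lemma one_tensor_group: "\<one>\<^bsub>tensor_group R N M\<^esub> = tensor_subgroup R N M"
  by (simp add: tensor_group_def)

text \<open>This turns vanishing in the tensor product into membership of a formal sum in the group
  of relations, the form in which tensors are computed with later.\<close>

lemma tensor_coset_eq_one_iff:
  assumes "z \<in> carrier (free_Abelian_group (carrier N \<times> carrier M))"
  shows "r_coset (free_Abelian_group (carrier N \<times> carrier M)) (tensor_subgroup R N M) z
      = \<one>\<^bsub>tensor_group R N M\<^esub> \<longleftrightarrow> z \<in> tensor_subgroup R N M"
  unfolding one_tensor_group
  using group.coset_join1[OF group_free_Abelian_group _ assms tensor_subgroup_subgroup]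
    group.coset_join2[OF group_free_Abelian_group assms tensor_subgroup_subgroup] by blast

lemma zero_mod_hom: "(\<lambda>_. \<zero>\<^bsub>M\<^esub>) \<in> mod_hom R N M"
proof -
  interpret M: module R M by fact
  show ?thesis by (auto simp: mod_hom_def hom_def)
qed

end

section \<open>What flatness and faithful flatness say about a single map or module\<close>

lemma frag_map_fst_zero:
  assumes N: "module R N" and N': "module R N'" and M: "module R M"
    and z: "z \<in> carrier (free_Abelian_group (carrier N \<times> carrier M))"
  shows "frag_map_fst (\<lambda>_. \<zero>\<^bsub>N'\<^esub>) z \<in> tensor_subgroup R N' M"
proof -
  have "Poly_Mapping.keys z \<subseteq> carrier N \<times> carrier M" using z by simp
  then show ?thesis
    unfolding frag_map_fst_def
  proof (induction z rule: frag_induction)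
    case zero
    then show ?case using subgroup.one_closed[OF tensor_subgroup_subgroup[OF N' M]] by simp
  next
    case (one x)
    then show ?case using tensor_subgroup_zero_left[OF N' M] by auto
  next
    case (diff a b)
    then show ?case using tensor_subgroup_closed(2)[OF N' M] by (simp add: frag_extend_diff)
  qed
qed

text \<open>Flatness is applied to the sequence \<open>N \<rightarrow> N \<rightarrow> N'\<close> of
  the zero map and \<open>f\<close>, which is exact because \<open>f\<close> has zero kernel. The
  zero endomorphism stands in for the map out of the zero module.\<close>

lemma flat_module_reflects_tensor_subgroup:
  fixes R :: "('a, 'r) ring_scheme" and N N' :: "'a test_module"
  assumes flat: "flat_module R M" and N: "module R N" and N': "module R N'"
    and f: "f \<in> mod_hom R N N'" and inj: "\<And>x. x \<in> carrier N \<Longrightarrow> f x = \<zero>\<^bsub>N'\<^esub> \<Longrightarrow> x = \<zero>\<^bsub>N\<^esub>"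
    and z: "z \<in> carrier (free_Abelian_group (carrier N \<times> carrier M))"
    and fz: "frag_map_fst f z \<in> tensor_subgroup R N' M"
  shows "z \<in> tensor_subgroup R N M"
proof -
  have M: "module R M" using flat unfolding flat_module_def by (rule conjunct1)
  interpret N: module R N by fact
  interpret N': module R N' by fact
  let ?F = "free_Abelian_group (carrier N \<times> carrier M)"
  let ?o = "\<lambda>_. \<zero>\<^bsub>N\<^esub>"
  have f0: "f \<zero>\<^bsub>N\<^esub> = \<zero>\<^bsub>N'\<^esub>"
    using hom_one[of f "add_monoid N" "add_monoid N'"] f N.a_group N'.a_group
    by (simp add: mod_hom_def)
  have "{x \<in> carrier N. f x = \<zero>\<^bsub>N'\<^esub>} = {\<zero>\<^bsub>N\<^esub>}"
    using inj f0 N.zero_closed by blast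
  moreover have "?o ` carrier N = {\<zero>\<^bsub>N\<^esub>}"
    using N.zero_closed by blast
  ultimately have "exact_pair (add_monoid N) (add_monoid N) (add_monoid N') ?o f"
    by (simp add: exact_pair_def kernel_def)
  then have ex: "tensor_map R N M ?o ` carrier (tensor_group R N M)
      = kernel (tensor_group R N M) (tensor_group R N' M) (tensor_map R N' M f)"
    using flat[unfolded flat_module_def, THEN conjunct2, rule_format, OF zero_mod_hom[OF N N] f N N N']
    by (simp only: exact_pair_def)
  let ?c = "r_coset ?F (tensor_subgroup R N M)"
  have "tensor_map R N' M f (?c z) = \<one>\<^bsub>tensor_group R N' M\<^esub>"
    unfolding tensor_map_coset[OF N N' M f z]
    using tensor_coset_eq_one_iff[OF N' M hom_in_carrier[OF frag_map_fst_hom[OF f] z]] fz by simp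
  then have "?c z \<in> kernel (tensor_group R N M) (tensor_group R N' M) (tensor_map R N' M f)"
    using z unfolding kernel_def tensor_group_def carrier_FactGroup by blast
  then obtain w where w: "w \<in> carrier ?F" and eq: "?c z = tensor_map R N M ?o (?c w)"
    unfolding ex[symmetric] by (auto simp: tensor_group_def carrier_FactGroup)
  \<comment> \<open>By exactness the class of \<open>z\<close> comes from the tensored zero map,
    whose image is trivial.\<close>
  have "?c z = \<one>\<^bsub>tensor_group R N M\<^esub>"
    unfolding eq tensor_map_coset[OF N N M zero_mod_hom[OF N N] w]
    using tensor_coset_eq_one_iff[OF N M hom_in_carrier[OF frag_map_fst_hom[OF zero_mod_hom[OF N N]] w]]
      frag_map_fst_zero[OF N N M w] by simp
  then show ?thesis using tensor_coset_eq_one_iff[OF N M z] by simp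
qed

text \<open>The sequence \<open>N \<rightarrow> N \<rightarrow> N\<close> of zero maps is exact only
  if \<open>N\<close> is zero, whereas the tensored sequence is exact once the tensor product is
  zero.\<close>

lemma faithfully_flat_module_reflects_zero:
  fixes R :: "('a, 'r) ring_scheme" and N :: "'a test_module"
  assumes flat: "faithfully_flat_module R M" and N: "module R N"
    and triv: "tensor_subgroup R N M = carrier (free_Abelian_group (carrier N \<times> carrier M))"
  shows "carrier N = {\<zero>\<^bsub>N\<^esub>}"
proof -
  have M: "module R M" using flat unfolding faithfully_flat_module_def by (rule conjunct1)
  interpret N: module R N by fact
  let ?o = "\<lambda>_. \<zero>\<^bsub>N\<^esub>"
  note z = zero_mod_hom[OF N N]
  interpret G: comm_group "tensor_group R N M" by (rule comm_group_tensor_group[OF N M])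
  have "Z = \<one>\<^bsub>tensor_group R N M\<^esub>" if "Z \<in> carrier (tensor_group R N M)" for Z
    using that tensor_coset_eq_one_iff[OF N M] triv
    unfolding tensor_group_def carrier_FactGroup by auto
  then have G: "carrier (tensor_group R N M) = {\<one>\<^bsub>tensor_group R N M\<^esub>}"
    using G.one_closed by blast
  have "tensor_map R N M ?o \<one>\<^bsub>tensor_group R N M\<^esub> = \<one>\<^bsub>tensor_group R N M\<^esub>"
    using hom_in_carrier[OF tensor_map_hom[OF N N M z] G.one_closed] unfolding G by blast
  then have "exact_pair (tensor_group R N M) (tensor_group R N M) (tensor_group R N M)
      (tensor_map R N M ?o) (tensor_map R N M ?o)"
    unfolding exact_pair_def kernel_def G by auto
  moreover have "exact_pair (add_monoid N) (add_monoid N) (add_monoid N) ?o ?o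
      \<longleftrightarrow> exact_pair (tensor_group R N M) (tensor_group R N M) (tensor_group R N M)
        (tensor_map R N M ?o) (tensor_map R N M ?o)"
    using flat[unfolded faithfully_flat_module_def, THEN conjunct2, rule_format, OF z z N N N] .
  ultimately have "?o ` carrier N = carrier N"
    unfolding exact_pair_def kernel_def by simp
  then show ?thesis using N.zero_closed by blast
qed


section \<open>Cyclic test modules\<close>

text \<open>Test modules have elements of type \<^typ>\<open>'a list set\<close>, so a residue class is encoded as a set of
  one-element lists.\<close>

definition cyclic_class :: "('a, 'r) ring_scheme \<Rightarrow> 'a set \<Rightarrow> 'a \<Rightarrow> 'a list set"
  where "cyclic_class R J x = (\<lambda>a. [a]) ` (J +>\<^bsub>R\<^esub> x)"

text \<open>An arbitrary representative, taken out of its one-element list. The operations below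
  pass back to classes at once, so for an ideal \<open>J\<close> the choice does not affect
  them.\<close>

definition cyclic_rep :: "'a list set \<Rightarrow> 'a"
  where "cyclic_rep Z = hd (SOME l. l \<in> Z)"

text \<open>The module \<open>R/J\<close>. A module record extends a ring record, but a module has
  no product or unit of its own, hence \<open>undefined\<close>.\<close>

definition cyclic_module :: "('a, 'r) ring_scheme \<Rightarrow> 'a set \<Rightarrow> 'a test_module"
  where "cyclic_module R J = \<lparr>carrier = cyclic_class R J ` carrier R, monoid.mult = undefined,
    one = undefined, ring.zero = cyclic_class R J \<zero>\<^bsub>R\<^esub>,
    ring.add = (\<lambda>Z Y. cyclic_class R J (cyclic_rep Z \<oplus>\<^bsub>R\<^esub> cyclic_rep Y)),
    smult = (\<lambda>r Z. cyclic_class R J (r \<otimes>\<^bsub>R\<^esub> cyclic_rep Z))\<rparr>"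

lemma cyclic_module_simps [simp]:
  "carrier (cyclic_module R J) = cyclic_class R J ` carrier R"
  "\<zero>\<^bsub>cyclic_module R J\<^esub> = cyclic_class R J \<zero>\<^bsub>R\<^esub>"
  by (simp_all add: cyclic_module_def)

context cring
begin

lemma cyclic_class_eq_iff:
  assumes J: "ideal J R" and x: "x \<in> carrier R" "y \<in> carrier R"
  shows "cyclic_class R J x = cyclic_class R J y \<longleftrightarrow> x \<ominus> y \<in> J"
  unfolding cyclic_class_def quotient_eq_iff_same_a_r_cos[OF J x]
  by (rule inj_image_eq_iff) (simp add: inj_on_def)

lemma cyclic_rep_class:
  assumes J: "ideal J R" and x: "x \<in> carrier R"
  shows "cyclic_rep (cyclic_class R J x) \<in> carrier R" "cyclic_rep (cyclic_class R J x) \<ominus> x \<in> J"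
proof -
  interpret J: ideal J R by fact
  let ?Z = "cyclic_class R J x"
  have "[x] \<in> ?Z"
    unfolding cyclic_class_def using J.a_rcos_self[OF x] by simp
  then have "(SOME l. l \<in> ?Z) \<in> ?Z" by (rule someI)
  then obtain j where j: "j \<in> J" "cyclic_rep ?Z = j \<oplus> x"
    unfolding cyclic_rep_def cyclic_class_def a_r_coset_def' by auto
  then show "cyclic_rep ?Z \<in> carrier R" "cyclic_rep ?Z \<ominus> x \<in> J"
    using J.Icarr[OF j(1)] x by (simp_all add: a_minus_def a_assoc r_neg)
qed

lemma cyclic_module_add:
  assumes J: "ideal J R" and x: "x \<in> carrier R" "y \<in> carrier R"
  shows "cyclic_class R J x \<oplus>\<^bsub>cyclic_module R J\<^esub> cyclic_class R J y = cyclic_class R J (x \<oplus> y)"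
proof -
  interpret J: ideal J R by fact
  let ?x = "cyclic_rep (cyclic_class R J x)" and ?y = "cyclic_rep (cyclic_class R J y)"
  note r = cyclic_rep_class[OF J x(1)] cyclic_rep_class[OF J x(2)]
  have "(?x \<oplus> ?y) \<ominus> (x \<oplus> y) = (?x \<ominus> x) \<oplus> (?y \<ominus> y)" using r x by algebra
  then have "(?x \<oplus> ?y) \<ominus> (x \<oplus> y) \<in> J" using r J.a_closed by simp
  then show ?thesis using r x by (simp add: cyclic_module_def cyclic_class_eq_iff[OF J])
qed

text \<open>Two representatives modulo \<open>J\<close> differ by an element of \<open>J\<close>,
  which \<open>a\<close> sends into \<open>K\<close>. The case \<open>K = J\<close> gives the scalar
  action, the general case a map \<open>R/J \<rightarrow> R/K\<close>.\<close>

lemma cyclic_class_mult_rep: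
  assumes J: "ideal J R" and K: "ideal K R" and a: "a \<in> carrier R" and x: "x \<in> carrier R"
    and aJ: "\<And>j. j \<in> J \<Longrightarrow> a \<otimes> j \<in> K"
  shows "cyclic_class R K (a \<otimes> cyclic_rep (cyclic_class R J x)) = cyclic_class R K (a \<otimes> x)"
proof -
  let ?x = "cyclic_rep (cyclic_class R J x)"
  note r = cyclic_rep_class[OF J x]
  have "a \<otimes> ?x \<ominus> a \<otimes> x = a \<otimes> (?x \<ominus> x)" using r x a by algebra
  then have "a \<otimes> ?x \<ominus> a \<otimes> x \<in> K" using r aJ by simp
  then show ?thesis using r x a by (simp add: cyclic_class_eq_iff[OF K])
qed

lemma cyclic_module_smult:
  assumes J: "ideal J R" and x: "r \<in> carrier R" "x \<in> carrier R"
  shows "r \<odot>\<^bsub>cyclic_module R J\<^esub> cyclic_class R J x = cyclic_class R J (r \<otimes> x)"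
  using cyclic_class_mult_rep[OF J J x] ideal.I_l_closed[OF J _ x(1)]
  by (simp add: cyclic_module_def)

lemma module_cyclic_module:
  assumes J: "ideal J R"
  shows "module R (cyclic_module R J)"
proof (rule moduleI)
  show "abelian_group (cyclic_module R J)"
  proof (rule abelian_groupI)
    fix Z assume "Z \<in> carrier (cyclic_module R J)"
    then obtain x where x: "x \<in> carrier R" "Z = cyclic_class R J x" by auto
    then show "\<exists>Y\<in>carrier (cyclic_module R J). Y \<oplus>\<^bsub>cyclic_module R J\<^esub> Z = \<zero>\<^bsub>cyclic_module R J\<^esub>"
      by (intro bexI[of _ "cyclic_class R J (\<ominus> x)"]) (auto simp: cyclic_module_add[OF J] l_neg)
  qed (auto simp: cyclic_module_add[OF J] a_ac)
qed (auto simp: cyclic_module_add[OF J] cyclic_module_smult[OF J] l_distr r_distr m_assoc is_cring)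

lemma cyclic_module_mult_hom:
  assumes J: "ideal J R" and K: "ideal K R" and a: "a \<in> carrier R"
    and aJ: "\<And>j. j \<in> J \<Longrightarrow> a \<otimes> j \<in> K"
  shows "(\<lambda>Z. cyclic_class R K (a \<otimes> cyclic_rep Z)) \<in> mod_hom R (cyclic_module R J) (cyclic_module R K)"
  using a
  by (auto simp: mod_hom_def hom_def cyclic_module_add[OF J] cyclic_module_add[OF K]
      cyclic_module_smult[OF J] cyclic_module_smult[OF K] cyclic_class_mult_rep[OF J K a _ aJ]
      r_distr m_lcomm)

end

section \<open>Tensoring \<open>R/J\<close> with an extension ring, for use with both
  \<open>R \<subseteq> T\<close> and \<open>A \<subseteq> B\<close>\<close>

locale ring_extension = R: cring R + S: cring S
  for R :: "('a, 'r) ring_scheme" and S :: "('a, 's) ring_scheme" +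
  assumes carrier_subset: "carrier R \<subseteq> carrier S"
    and one_eq: "\<one>\<^bsub>R\<^esub> = \<one>\<^bsub>S\<^esub>"
    and add_eq: "\<And>x y. x \<in> carrier R \<Longrightarrow> y \<in> carrier R \<Longrightarrow> x \<oplus>\<^bsub>R\<^esub> y = x \<oplus>\<^bsub>S\<^esub> y"
    and mult_eq: "\<And>x y. x \<in> carrier R \<Longrightarrow> y \<in> carrier R \<Longrightarrow> x \<otimes>\<^bsub>R\<^esub> y = x \<otimes>\<^bsub>S\<^esub> y"
begin

lemma module_ext: "module R (ring_module S)"
  by (rule module_ring_module)
    (simp_all add: R.is_cring S.is_cring carrier_subset one_eq add_eq mult_eq)

lemma minus_eq:
  assumes "x \<in> carrier R" "y \<in> carrier R"
  shows "x = (x \<ominus>\<^bsub>R\<^esub> y) \<oplus>\<^bsub>S\<^esub> y"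
proof -
  have "x = (x \<ominus>\<^bsub>R\<^esub> y) \<oplus>\<^bsub>R\<^esub> y" using assms by algebra
  then show ?thesis using assms by (simp add: add_eq)
qed

text \<open>The bilinear pairing \<open>(x, y) \<mapsto> x y\<close> from \<open>R/J \<times> S\<close> to \<open>S/JS\<close> detects \<open>1 \<otimes> 1\<close>.\<close>

lemma one_mem_genideal_of_tensor:
  assumes J: "ideal J R"
    and H: "frag_of (cyclic_class R J \<one>\<^bsub>R\<^esub>, \<one>\<^bsub>S\<^esub>) \<in> tensor_subgroup R (cyclic_module R J) (ring_module S)"
  shows "\<one>\<^bsub>S\<^esub> \<in> Idl\<^bsub>S\<^esub> J"
proof -
  interpret J: ideal J R by fact
  let ?K = "Idl\<^bsub>S\<^esub> J" and ?N = "cyclic_module R J" and ?M = "ring_module S"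
  let ?F = "free_Abelian_group (carrier ?N \<times> carrier ?M)"
  have JS: "J \<subseteq> carrier S" using J.a_subset carrier_subset by blast
  have K: "ideal ?K S" by (rule S.genideal_ideal[OF JS])
  have JK: "J \<subseteq> ?K" by (rule S.genideal_self[OF JS])
  interpret K: ideal ?K S by fact
  interpret Q: cring "S Quot ?K" by (rule ideal.quotient_is_cring[OF K S.is_cring])
  let ?G = "add_monoid (S Quot ?K)"
  define \<beta> where "\<beta> = (\<lambda>(Z, y). ?K +>\<^bsub>S\<^esub> (cyclic_rep Z \<otimes>\<^bsub>S\<^esub> y))"
  \<comment> \<open>Independence of the representative: two of them differ by an element of
    \<open>J\<close>, whose product with \<open>y\<close> lies in \<open>?K\<close>.\<close>
  have \<beta>: "\<beta> (cyclic_class R J x, y) = ?K +>\<^bsub>S\<^esub> (x \<otimes>\<^bsub>S\<^esub> y)" if x: "x \<in> carrier R" and y: "y \<in> carrier S" for x y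
  proof -
    let ?x = "cyclic_rep (cyclic_class R J x)"
    note r = R.cyclic_rep_class[OF J x]
    have xS: "x \<in> carrier S" "?x \<in> carrier S" "?x \<ominus>\<^bsub>R\<^esub> x \<in> carrier S"
      using x r carrier_subset JS by auto
    have "?x \<otimes>\<^bsub>S\<^esub> y \<ominus>\<^bsub>S\<^esub> x \<otimes>\<^bsub>S\<^esub> y = ((?x \<ominus>\<^bsub>R\<^esub> x) \<oplus>\<^bsub>S\<^esub> x) \<otimes>\<^bsub>S\<^esub> y \<ominus>\<^bsub>S\<^esub> x \<otimes>\<^bsub>S\<^esub> y"
      using minus_eq[OF r(1) x] by simp
    also have "\<dots> = (?x \<ominus>\<^bsub>R\<^esub> x) \<otimes>\<^bsub>S\<^esub> y" using xS y by algebra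
    also have "\<dots> \<in> ?K" using JK r K.I_r_closed y by blast
    finally show ?thesis
      unfolding \<beta>_def using S.quotient_eq_iff_same_a_r_cos[OF K] xS y by simp
  qed
  have cl: "?K +>\<^bsub>S\<^esub> y \<in> carrier ?G" if "y \<in> carrier S" for y
    using that by (auto simp: FactRing_def A_RCOSETS_def')
  have "\<beta> ` (carrier ?N \<times> carrier ?M) \<subseteq> carrier ?G"
    using \<beta> cl carrier_subset by auto
  \<comment> \<open>The pairing extends to formal sums by the universal property of the free Abelian
    group. It remains to see that bilinearity makes \<open>h\<close> kill the relators.\<close>
  then obtain h where h: "h \<in> hom ?F ?G" and hf: "\<And>z. z \<in> carrier ?N \<times> carrier ?M \<Longrightarrow> h (frag_of z) = \<beta> z"
    by (rule comm_group.free_Abelian_group_universal[OF Q.a_comm_group]) auto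
  interpret h: group_hom ?F ?G h
    by (intro group_hom.intro group_hom_axioms.intro group_free_Abelian_group Q.a_group h)
  have hfrag: "h (frag_of (cyclic_class R J x, y)) = ?K +>\<^bsub>S\<^esub> (x \<otimes>\<^bsub>S\<^esub> y)"
    if "x \<in> carrier R" "y \<in> carrier S" for x y
    using that by (simp add: hf \<beta>)
  have plus: "(?K +>\<^bsub>S\<^esub> x) \<oplus>\<^bsub>S Quot ?K\<^esub> (?K +>\<^bsub>S\<^esub> y) = ?K +>\<^bsub>S\<^esub> (x \<oplus>\<^bsub>S\<^esub> y)"
    if "x \<in> carrier S" "y \<in> carrier S" for x y
    using K.a_rcos_sum[OF that] by (simp add: FactRing_def)
  have ker: "u - v \<in> kernel ?F ?G h" if "u \<in> carrier ?F" "v \<in> carrier ?F" "h u = h v" for u v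
  proof -
    have "u - v = u \<otimes>\<^bsub>?F\<^esub> inv\<^bsub>?F\<^esub> v" using that by simp
    moreover have "h (u \<otimes>\<^bsub>?F\<^esub> inv\<^bsub>?F\<^esub> v) = \<one>\<^bsub>?G\<^esub>"
      using that h.hom_mult h.hom_inv h.inv_closed h.G.inv_closed group.r_inv[OF Q.a_group] h.hom_closed by metis
    moreover have "u \<otimes>\<^bsub>?F\<^esub> inv\<^bsub>?F\<^esub> v \<in> carrier ?F"
      using that by (intro h.G.m_closed h.G.inv_closed)
    ultimately show ?thesis by (simp only: kernel_def mem_Collect_eq)
  qed
  \<comment> \<open>The difference is regrouped as \<open>u - (w + v)\<close>, which fixes the order
    of the summands in the condition on \<open>h u\<close>.\<close>
  have ker3: "u - v - w \<in> kernel ?F ?G h"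
    if "u \<in> carrier ?F" "v \<in> carrier ?F" "w \<in> carrier ?F" "h u = h w \<oplus>\<^bsub>S Quot ?K\<^esub> h v" for u v w
  proof -
    have "u - (w \<otimes>\<^bsub>?F\<^esub> v) \<in> kernel ?F ?G h"
      using that by (intro ker h.G.m_closed) (simp_all only: h.hom_mult monoid.simps)
    then show ?thesis by (simp add: algebra_simps)
  qed
  have fc: "frag_of (cyclic_class R J x, y) \<in> carrier ?F" if "x \<in> carrier R" "y \<in> carrier S" for x y
    using that by simp
  have "tensor_relators R ?N ?M \<subseteq> kernel ?F ?G h"
  proof -
    have "frag_of (cyclic_class R J x \<oplus>\<^bsub>?N\<^esub> cyclic_class R J x', y) - frag_of (cyclic_class R J x, y)
        - frag_of (cyclic_class R J x', y) \<in> kernel ?F ?G h"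
      if "x \<in> carrier R" "x' \<in> carrier R" "y \<in> carrier S" for x x' y
      unfolding R.cyclic_module_add[OF J that(1,2)]
    proof (intro ker3 fc R.a_closed that)
      have "x \<in> carrier S" "x' \<in> carrier S" using that carrier_subset by auto
      then have "(x \<oplus>\<^bsub>S\<^esub> x') \<otimes>\<^bsub>S\<^esub> y = x' \<otimes>\<^bsub>S\<^esub> y \<oplus>\<^bsub>S\<^esub> x \<otimes>\<^bsub>S\<^esub> y" using that by algebra
      then show "h (frag_of (cyclic_class R J (x \<oplus>\<^bsub>R\<^esub> x'), y)) = h (frag_of (cyclic_class R J x', y))
          \<oplus>\<^bsub>S Quot ?K\<^esub> h (frag_of (cyclic_class R J x, y))"
        using that \<open>x \<in> carrier S\<close> \<open>x' \<in> carrier S\<close> hfrag[OF R.a_closed[OF that(1,2)] that(3)]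
        by (simp add: hfrag plus add_eq)
    qed
    moreover have "frag_of (cyclic_class R J x, y \<oplus>\<^bsub>?M\<^esub> y') - frag_of (cyclic_class R J x, y)
        - frag_of (cyclic_class R J x, y') \<in> kernel ?F ?G h"
      if "x \<in> carrier R" "y' \<in> carrier S" "y \<in> carrier S" for x y y'
      using that carrier_subset unfolding ring_module_simps(2)
      by (intro ker3 fc S.a_closed)
        (auto simp: hfrag plus S.r_distr S.a_comm subset_iff)
    moreover have "frag_of (r \<odot>\<^bsub>?N\<^esub> cyclic_class R J x, y) - frag_of (cyclic_class R J x, r \<odot>\<^bsub>?M\<^esub> y) \<in> kernel ?F ?G h"
      if "r \<in> carrier R" "x \<in> carrier R" "y \<in> carrier S" for r x y
      unfolding R.cyclic_module_smult[OF J that(1,2)] ring_module_simps(4)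
    proof (intro ker fc R.m_closed S.m_closed that subsetD[OF carrier_subset])
      have "r \<in> carrier S" "x \<in> carrier S" using that carrier_subset by auto
      then show "h (frag_of (cyclic_class R J (r \<otimes>\<^bsub>R\<^esub> x), y)) = h (frag_of (cyclic_class R J x, r \<otimes>\<^bsub>S\<^esub> y))"
        using that hfrag[OF R.m_closed[OF that(1,2)] that(3)]
        by (simp add: hfrag mult_eq S.m_ac)
    qed
    ultimately show ?thesis
      unfolding tensor_relators_def cyclic_module_simps by auto
  qed
  \<comment> \<open>The kernel is a subgroup, so it contains everything the relators generate. Hence
    \<open>h\<close> descends to the tensor product, where it maps \<open>1 \<otimes> 1\<close> to
    the class of one modulo \<open>?K\<close>.\<close>
  then have "tensor_subgroup R ?N ?M \<subseteq> kernel ?F ?G h"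
    unfolding tensor_subgroup_def by (intro h.G.generate_subgroup_incl h.subgroup_kernel)
  then have "h (frag_of (cyclic_class R J \<one>\<^bsub>R\<^esub>, \<one>\<^bsub>S\<^esub>)) = \<one>\<^bsub>?G\<^esub>"
    using H by (auto simp: kernel_def)
  then have "?K +>\<^bsub>S\<^esub> \<one>\<^bsub>S\<^esub> = ?K"
    using hfrag[OF R.one_closed S.one_closed] by (simp add: one_eq FactRing_def)
  then show ?thesis using K.a_rcos_self[of "\<one>\<^bsub>S\<^esub>"] by simp
qed

text \<open>Elements of \<open>J\<close> move across the tensor sign and kill \<open>R/J\<close>.
  The \<open>b \<in> S\<close> for which all tensors \<open>Z \<otimes> b s\<close> vanish form an
  ideal of \<open>S\<close>; as it contains \<open>J\<close>, it contains one.\<close>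

lemma tensor_subgroup_cyclic_eq_carrier:
  assumes J: "ideal J R" and gen: "\<one>\<^bsub>S\<^esub> \<in> Idl\<^bsub>S\<^esub> J"
  shows "tensor_subgroup R (cyclic_module R J) (ring_module S)
    = carrier (free_Abelian_group (carrier (cyclic_module R J) \<times> carrier (ring_module S)))"
proof -
  interpret J: ideal J R by fact
  let ?N = "cyclic_module R J" and ?M = "ring_module S"
  note N = R.module_cyclic_module[OF J] and M = module_ext
  interpret N: module R ?N by fact
  have JS: "J \<subseteq> carrier S" using J.a_subset carrier_subset by blast
  define K where "K = {b \<in> carrier S. \<forall>Z\<in>carrier ?N. \<forall>s\<in>carrier S.
    frag_of (Z, b \<otimes>\<^bsub>S\<^esub> s) \<in> tensor_subgroup R ?N ?M}"
  have JK: "J \<subseteq> K"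
  proof
    fix j assume j: "j \<in> J"
    have "frag_of (cyclic_class R J x, j \<otimes>\<^bsub>S\<^esub> s) \<in> tensor_subgroup R ?N ?M"
      if x: "x \<in> carrier R" and s: "s \<in> carrier S" for x s
    proof -
      have "j \<otimes>\<^bsub>R\<^esub> x \<ominus>\<^bsub>R\<^esub> \<zero>\<^bsub>R\<^esub> \<in> J"
        using J.I_r_closed[OF j x] J.Icarr[OF j] x by (simp add: R.minus_eq)
      then have "j \<odot>\<^bsub>?N\<^esub> cyclic_class R J x = \<zero>\<^bsub>?N\<^esub>"
        using J.Icarr[OF j] x by (simp add: R.cyclic_module_smult[OF J] R.cyclic_class_eq_iff[OF J])
      then have "frag_of (j \<odot>\<^bsub>?N\<^esub> cyclic_class R J x, s) \<in> tensor_subgroup R ?N ?M"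
        using tensor_subgroup_zero_left[OF N M] s by simp
      then show ?thesis
        using tensor_subgroup_smult_iff[OF N M J.Icarr[OF j], of "cyclic_class R J x" s] x s by simp
    qed
    then show "j \<in> K" using j JS unfolding K_def by auto
  qed
  \<comment> \<open>A factor \<open>t\<close> is absorbed into \<open>s\<close>, which is why
    \<open>K\<close> quantifies over all \<open>s\<close>; the factor minus one later yields
    negatives.\<close>
  have mult: "b \<otimes>\<^bsub>S\<^esub> t \<in> K" if "b \<in> K" "t \<in> carrier S" for b t
    using that by (auto simp: K_def S.m_assoc)
  have "ideal K S"
  proof (rule idealI[OF S.ring_axioms])
    show "subgroup K (add_monoid S)"
    proof (rule S.add.subgroupI)
      show "K \<noteq> {}" using JK J.zero_closed by blast
      show "\<ominus>\<^bsub>S\<^esub> b \<in> K" if "b \<in> K" for b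
      proof -
        have "\<ominus>\<^bsub>S\<^esub> b = b \<otimes>\<^bsub>S\<^esub> (\<ominus>\<^bsub>S\<^esub> \<one>\<^bsub>S\<^esub>)" using that by (simp add: K_def S.r_minus)
        then show ?thesis using mult[OF that, of "\<ominus>\<^bsub>S\<^esub> \<one>\<^bsub>S\<^esub>"] by simp
      qed
      show "b \<oplus>\<^bsub>S\<^esub> b' \<in> K" if "b \<in> K" "b' \<in> K" for b b'
        using that tensor_subgroup_add_right[OF N M] by (auto simp: K_def S.l_distr)
    qed (auto simp: K_def)
    show "b \<otimes>\<^bsub>S\<^esub> t \<in> K" "t \<otimes>\<^bsub>S\<^esub> b \<in> K" if "b \<in> K" "t \<in> carrier S" for b t
      using mult[OF that] that S.m_comm[of t b] by (auto simp: K_def)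
  qed
  then have "\<one>\<^bsub>S\<^esub> \<in> K" using S.genideal_minimal[OF _ JK] gen by blast
  then have "frag_of (Z, y) \<in> tensor_subgroup R ?N ?M" if "Z \<in> carrier ?N" "y \<in> carrier S" for Z y
    using that unfolding K_def by force
  then show ?thesis by (intro tensor_subgroup_eq_carrierI[OF N M]) simp_all
qed

end


section \<open>Regular conductor squares\<close>

context conductor_square
begin

abbreviation "R_ring \<equiv> T\<lparr>carrier := R\<rparr>"

lemma ring_extension_T: "ring_extension R_ring T"
  using cring_R is_cring subset
  by (intro ring_extension.intro ring_extension_axioms.intro) auto

lemma ring_extension_Quot: "ring_extension (R_ring Quot C) (T Quot C)"
  using ideal.quotient_is_cring[OF ideal_R cring_R] ideal.quotient_is_cring[OF ideal_T is_cring]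
    quotient_subset
  by (intro ring_extension.intro ring_extension_axioms.intro)
    (simp_all add: FactRing_def rcoset_mult_def quotient_coset set_add_def set_mult_def)

text \<open>This is the ideal \<open>I\<close> of the argument. Closure under scalars from
  \<open>R\<close> is associativity: \<open>(x a) t = x (a t)\<close>.\<close>

lemma ideal_colon:
  assumes t: "t \<in> carrier T"
  shows "ideal {r \<in> R. r \<otimes> t \<in> R} R_ring"
proof (rule idealI)
  interpret R: cring R_ring by (rule cring_R)
  show "ring R_ring" by (rule R.ring_axioms)
  note sub = subsetD[OF subset]
  show "subgroup {r \<in> R. r \<otimes> t \<in> R} (add_monoid R_ring)"
  proof (rule R.add.subgroupI)
    fix a assume a: "a \<in> {r \<in> R. r \<otimes> t \<in> R}"
    \<comment> \<open>The inverse in the subring is defined relative to the carrier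
      \<open>R\<close>, so it has to be identified with the inverse in \<open>T\<close>.\<close>
    have neg: "\<ominus>\<^bsub>R_ring\<^esub> x = \<ominus> x" "\<ominus> x \<in> R" if "x \<in> R" for x
    proof -
      show "\<ominus>\<^bsub>R_ring\<^esub> x = \<ominus> x"
        using that sub R.l_neg[of x] R.a_inv_closed[of x] by (intro minus_equality[symmetric]) auto
      then show "\<ominus> x \<in> R" using R.a_inv_closed[of x] that by simp
    qed
    show "\<ominus>\<^bsub>R_ring\<^esub> a \<in> {r \<in> R. r \<otimes> t \<in> R}"
      using a sub t neg by (auto simp: l_minus)
  qed (use t sub R.zero_closed R.a_closed in \<open>auto simp: l_distr intro!: exI[of _ \<zero>]\<close>)
  show l: "x \<otimes>\<^bsub>R_ring\<^esub> a \<in> {r \<in> R. r \<otimes> t \<in> R}"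
    if "a \<in> {r \<in> R. r \<otimes> t \<in> R}" "x \<in> carrier R_ring" for a x
    using that t sub R.m_closed[of x "a \<otimes> t"] R.m_closed[of x a] by (auto simp: m_assoc)
  show "a \<otimes>\<^bsub>R_ring\<^esub> x \<in> {r \<in> R. r \<otimes> t \<in> R}"
    if "a \<in> {r \<in> R. r \<otimes> t \<in> R}" "x \<in> carrier R_ring" for a x
    using l[OF that] that R.m_comm[of a x] by auto
qed

end

section \<open>Flatness forces \<open>I T = T\<close>, and two consequences of this equality\<close>

lemma (in regular_conductor_square) flat_imp_one_mem_genideal_colon:
  assumes flat: "flat_module R_ring (ring_module T)" and t: "t \<in> carrier T"
  shows "\<one> \<in> Idl\<^bsub>T\<^esub> {r \<in> R. r \<otimes> t \<in> R}"
proof -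
  interpret R: cring R_ring by (rule cring_R)
  interpret E: ring_extension R_ring T by (rule ring_extension_T)
  interpret C: ideal C T by (rule ideal_T)
  note sub = subsetD[OF subset]
  obtain c where c: "c \<in> C" and reg: "\<And>s. s \<in> carrier T \<Longrightarrow> c \<otimes> s = \<zero> \<Longrightarrow> s = \<zero>"
    using regular by blast
  have cR: "c \<in> R" and cT: "c \<in> carrier T" using c C_subset sub by auto
  let ?I = "{r \<in> R. r \<otimes> t \<in> R}"
  \<comment> \<open>Although \<open>t\<close> may lie outside \<open>R\<close>, the product
    \<open>c t\<close> lies in \<open>C\<close> and hence in \<open>R\<close>, so it can serve as a
    multiplier on \<open>R\<close>.\<close>
  define a where "a = c \<otimes> t"
  have a: "a \<in> R" unfolding a_def using C.I_r_closed[OF c t] C_subset by blast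
  let ?K = "PIdl\<^bsub>R_ring\<^esub> c"
  have I: "ideal ?I R_ring" by (rule ideal_colon[OF t])
  have K: "ideal ?K R_ring" using R.cgenideal_ideal cR by simp
  have memK: "x \<in> ?K \<longleftrightarrow> (\<exists>r\<in>R. x = r \<otimes> c)" for x by (auto simp: cgenideal_def)
  \<comment> \<open>For \<open>j \<in> I\<close> the factor \<open>j t\<close> is in
    \<open>R\<close>, so \<open>a j\<close> is an \<open>R\<close>-multiple of \<open>c\<close> and
    multiplication by \<open>a\<close> descends to \<open>R/I \<rightarrow> R/cR\<close>.\<close>
  have aI: "a \<otimes> j \<in> ?K" if "j \<in> ?I" for j
  proof -
    have "a \<otimes> j = (j \<otimes> t) \<otimes> c" unfolding a_def using that sub t cT by (simp add: m_ac)
    then show ?thesis using that memK by blast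
  qed
  let ?N = "cyclic_module R_ring ?I" and ?N' = "cyclic_module R_ring ?K" and ?M = "ring_module T"
  let ?e = "cyclic_class R_ring ?I" and ?e' = "cyclic_class R_ring ?K"
  define f where "f = (\<lambda>Z. ?e' (a \<otimes> cyclic_rep Z))"
  have f: "f \<in> mod_hom R_ring ?N ?N'"
    using R.cyclic_module_mult_hom[OF I K] a aI unfolding f_def by simp
  have fe: "f (?e x) = ?e' (a \<otimes> x)" if "x \<in> R" for x
    using R.cyclic_class_mult_rep[OF I K, of a x] a that aI unfolding f_def by simp
  have zero_iff: "cyclic_class R_ring J x = cyclic_class R_ring J \<zero> \<longleftrightarrow> x \<in> J"
    if "ideal J R_ring" "x \<in> R" for J x
    using R.cyclic_class_eq_iff[OF that(1), of x \<zero>] R.minus_zero that R.r_zero R.zero_closed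
    by (simp add: R.minus_eq)
  note N = R.module_cyclic_module[OF I] and N' = R.module_cyclic_module[OF K]
  have "frag_of (?e \<one>, \<one>) \<in> tensor_subgroup R_ring ?N ?M"
  proof (rule flat_module_reflects_tensor_subgroup[OF flat N N' f])
    fix Z assume "Z \<in> carrier ?N" "f Z = \<zero>\<^bsub>?N'\<^esub>"
    then obtain x where x: "x \<in> R" "Z = ?e x" "?e' (a \<otimes> x) = ?e' \<zero>" using fe by auto
    then have "a \<otimes> x \<in> ?K" using zero_iff[OF K, of "a \<otimes> x"] a by simp
    then obtain s where s: "s \<in> R" "a \<otimes> x = s \<otimes> c" using memK by blast
    \<comment> \<open>Injectivity of \<open>f\<close>: the equation \<open>c t x = s c\<close> can
      be cancelled by the regular element \<open>c\<close>, leaving \<open>x t = s \<in> R\<close>,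
      that is \<open>x \<in> I\<close>.\<close>
    then have "c \<otimes> (x \<otimes> t \<ominus> s) = \<zero>"
      unfolding a_def using x sub t cT by algebra
    then have "x \<otimes> t \<ominus> s = \<zero>" using reg x s sub t by simp
    then have "x \<otimes> t = s" using x s sub t by simp
    then show "Z = \<zero>\<^bsub>?N\<^esub>" using x s zero_iff[OF I, of x] by simp
  next
    show "frag_of (?e \<one>, \<one>) \<in> carrier (free_Abelian_group (carrier ?N \<times> carrier ?M))" by simp
    \<comment> \<open>In \<open>R/cR \<otimes> T\<close>, start from \<open>0 \<otimes> t\<close>
      with zero written as the class of \<open>c\<close>, move \<open>c\<close> to the right to get
      \<open>1 \<otimes> ct\<close>, then move \<open>a = ct\<close>, a scalar of \<open>R\<close>,
      to the left to reach \<open>f(1) \<otimes> 1\<close>.\<close>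
    have "c \<in> ?K" unfolding memK using cT by (intro bexI[of _ \<one>]) auto
    then have c0: "\<zero>\<^bsub>?N'\<^esub> = ?e' c" using zero_iff[OF K cR] by simp
    have "frag_of (\<zero>\<^bsub>?N'\<^esub>, t) \<in> tensor_subgroup R_ring ?N' ?M"
      using tensor_subgroup_zero_left[OF N' E.module_ext] t by simp
    moreover have "?e' c = c \<odot>\<^bsub>?N'\<^esub> ?e' \<one>"
      using R.cyclic_module_smult[OF K, of c \<one>] cR cT by simp
    ultimately have "frag_of (c \<odot>\<^bsub>?N'\<^esub> ?e' \<one>, t) \<in> tensor_subgroup R_ring ?N' ?M"
      using c0 by simp
    then have "frag_of (?e' \<one>, c \<otimes> t) \<in> tensor_subgroup R_ring ?N' ?M"
      using tensor_subgroup_smult_iff[OF N' E.module_ext, of c "?e' \<one>" t] cR t by simp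
    then have "frag_of (a \<odot>\<^bsub>?N'\<^esub> ?e' \<one>, \<one>) \<in> tensor_subgroup R_ring ?N' ?M"
      using tensor_subgroup_smult_iff[OF N' E.module_ext, of a "?e' \<one>" \<one>] a sub by (simp add: a_def)
    then show "frag_map_fst f (frag_of (?e \<one>, \<one>)) \<in> tensor_subgroup R_ring ?N' ?M"
      using R.cyclic_module_smult[OF K, of a \<one>] a fe[of \<one>] by (simp add: frag_map_fst_def)
  qed
  then show ?thesis using E.one_mem_genideal_of_tensor[OF I] by simp
qed

text \<open>Let \<open>J = I/C\<close>. The preimage \<open>?L\<close> of \<open>J B\<close> in
  \<open>T\<close> is an ideal containing \<open>I\<close>, hence contains one, so
  \<open>J B = B\<close>. Then \<open>A/J\<close> is a non-zero module whose tensor product with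
  \<open>B\<close> is zero.\<close>

lemma (in conductor_square) one_mem_genideal_imp_not_faithfully_flat:
  assumes I: "ideal I R_ring" and CI: "C \<subseteq> I" and one: "\<one> \<in> Idl\<^bsub>T\<^esub> I" "\<one> \<notin> I"
  shows "\<not> faithfully_flat_module (R_ring Quot C) (ring_module (T Quot C))"
proof
  assume ff: "faithfully_flat_module (R_ring Quot C) (ring_module (T Quot C))"
  interpret R: cring R_ring by (rule cring_R)
  interpret E: ring_extension "R_ring Quot C" "T Quot C" by (rule ring_extension_Quot)
  interpret I: ideal I R_ring by (rule I)
  interpret C: ideal C T by (rule ideal_T)
  let ?J = "(+>) C ` I"
  have J: "ideal ?J (R_ring Quot C)"
    using R.ring_ideal_imp_quot_ideal[OF ideal_R I] by (simp add: quotient_coset)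
  let ?L = "{s \<in> carrier T. C +> s \<in> Idl\<^bsub>T Quot C\<^esub> ?J}"
  have JB: "?J \<subseteq> carrier (T Quot C)"
    using ideal.Icarr[OF J] quotient_subset by blast
  interpret h: ring_hom_ring T "T Quot C" "(+>) C" by (rule C.rcos_ring_hom_ring)
  have "ideal ?L T"
    by (rule h.ideal_vimage) (rule E.S.genideal_ideal[OF JB])
  moreover have "I \<subseteq> ?L"
    using E.S.genideal_self[OF JB] I.Icarr subset by auto
  ultimately have "\<one> \<in> ?L" using genideal_minimal one(1) by blast
  then have "\<one>\<^bsub>T Quot C\<^esub> \<in> Idl\<^bsub>T Quot C\<^esub> ?J" by simp
  note triv = faithfully_flat_module_reflects_zero[OF ff E.R.module_cyclic_module[OF J]
      E.tensor_subgroup_cyclic_eq_carrier[OF J this]]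
  have "cyclic_class (R_ring Quot C) ?J \<one>\<^bsub>R_ring Quot C\<^esub> = cyclic_class (R_ring Quot C) ?J \<zero>\<^bsub>R_ring Quot C\<^esub>"
    using triv[unfolded cyclic_module_simps] imageI[OF E.R.one_closed] by (metis singletonD)
  then have "\<one>\<^bsub>R_ring Quot C\<^esub> \<in> ?J"
    using E.R.cyclic_class_eq_iff[OF J E.R.one_closed E.R.zero_closed] by (simp add: E.R.minus_eq)
  \<comment> \<open>Because \<open>C \<subseteq> I\<close>, membership in \<open>I\<close> depends
    only on the class modulo \<open>C\<close>, so \<open>\<one> \<in> I\<close> follows.\<close>
  then obtain i where i: "i \<in> I" "C +>\<^bsub>R_ring\<^esub> \<one> = C +>\<^bsub>R_ring\<^esub> i"
    unfolding FactRing_def monoid.simps quotient_coset by auto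
  then have "\<one> \<ominus>\<^bsub>R_ring\<^esub> i \<in> I"
    using R.quotient_eq_iff_same_a_r_cos[OF ideal_R, of \<one> i] I.Icarr[OF i(1)] CI i(2) one_closed by auto
  then have "(\<one> \<ominus>\<^bsub>R_ring\<^esub> i) \<oplus>\<^bsub>R_ring\<^esub> i \<in> I" using i I.a_closed by blast
  moreover have "(\<one> \<ominus>\<^bsub>R_ring\<^esub> i) \<oplus>\<^bsub>R_ring\<^esub> i = \<one>"
    using I.Icarr[OF i(1)] R.a_inv_closed[of i] R.minus_eq R.a_assoc R.l_neg R.r_zero by simp
  ultimately show False using one(2) by simp
qed

text \<open>Here \<open>E\<close> is \<open>I C\<close>. The elements of \<open>T\<close> that send
  \<open>C\<close> into \<open>E\<close> form an ideal of \<open>T\<close> containing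
  \<open>I\<close>, hence one, so \<open>C = I C\<close> and Nakayama's lemma applies.\<close>

lemma (in regular_conductor_square) one_mem_genideal_imp_not_finitely_generated:
  assumes I: "ideal I R_ring" and one: "\<one> \<in> Idl\<^bsub>T\<^esub> I" "\<one> \<notin> I"
    and S: "finite S" "S \<subseteq> C"
  shows "C \<noteq> Idl\<^bsub>R_ring\<^esub> S"
proof
  assume gen: "C = Idl\<^bsub>R_ring\<^esub> S"
  interpret R: cring R_ring by (rule cring_R)
  interpret I: ideal I R_ring by (rule I)
  interpret C: ideal C T by (rule ideal_T)
  note sub = subsetD[OF subset]
  have CR: "C \<subseteq> carrier R_ring" using C_subset by simp
  obtain ss where ss: "set ss = S" using S(1) finite_list by blast
  have ssR: "set ss \<subseteq> carrier R_ring" using ss S(2) CR by blast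
  define E where "E = R.Span I ss"
  interpret E: ideal E R_ring unfolding E_def by (rule R.ideal_Span[OF I ssR])
  have IC: "i \<otimes> x \<in> E" if i: "i \<in> I" and x: "x \<in> C" for i x
  proof -
    have iR: "i \<in> R" using I.Icarr[OF i] by simp
    have "ideal {x \<in> R. i \<otimes> x \<in> E} R_ring"
      using R.ideal_colon_element[OF E.ideal_axioms, of i] iR by simp
    moreover have "S \<subseteq> {x \<in> R. i \<otimes> x \<in> E}"
      using R.smult_mem_Span[OF I ssR i] ss ssR by (auto simp: E_def simp del: R.Span.simps)
    ultimately show ?thesis using R.genideal_minimal x gen by blast
  qed
  let ?K = "{b \<in> carrier T. \<forall>x\<in>C. b \<otimes> x \<in> E}"
  \<comment> \<open>This works because \<open>C\<close> is an ideal of \<open>T\<close>: for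
    \<open>x \<in> C\<close> also \<open>s x \<in> C\<close>, so \<open>b (s x)\<close> lies in
    \<open>E\<close>.\<close>
  have mult: "b \<otimes> s \<in> ?K" if "b \<in> ?K" "s \<in> carrier T" for b s
    using that C.I_l_closed C.Icarr by (auto simp: m_assoc)
  have "ideal ?K T"
  proof (rule idealI[OF ring_axioms])
    show "subgroup ?K (add_monoid T)"
    proof (rule add.subgroupI)
      show "?K \<noteq> {}" using E.zero_closed C.Icarr by (auto intro!: exI[of _ \<zero>])
      show "\<ominus> b \<in> ?K" if "b \<in> ?K" for b
      proof -
        have "\<ominus> b = b \<otimes> (\<ominus> \<one>)" using that by (simp add: r_minus)
        then show ?thesis using mult[OF that, of "\<ominus> \<one>"] by simp
      qed
      show "b \<oplus> b' \<in> ?K" if "b \<in> ?K" "b' \<in> ?K" for b b'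
        using that E.a_closed C.Icarr by (auto simp: l_distr)
    qed auto
    show "b \<otimes> s \<in> ?K" "s \<otimes> b \<in> ?K" if "b \<in> ?K" "s \<in> carrier T" for b s
      using mult[OF that] that m_comm[of s b] by auto
  qed
  moreover have "I \<subseteq> ?K" using IC I.Icarr sub by auto
  ultimately have "\<one> \<in> ?K" using genideal_minimal one(1) by blast
  then have "C \<subseteq> E" using C.Icarr by auto
  then obtain i where i: "i \<in> I" and ann: "\<And>x. x \<in> C \<Longrightarrow> (\<one> \<ominus>\<^bsub>R_ring\<^esub> i) \<otimes> x = \<zero>"
    using R.Nakayama_Span[OF I CR, of ss] ss S(2) unfolding E_def by auto
  obtain c where c: "c \<in> C" and reg: "\<And>s. s \<in> carrier T \<Longrightarrow> c \<otimes> s = \<zero> \<Longrightarrow> s = \<zero>"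
    using regular by blast
  have iR: "i \<in> R" using I.Icarr[OF i] by simp
  have d: "\<one> \<ominus>\<^bsub>R_ring\<^esub> i \<in> carrier T" using R.minus_closed[of \<one> i] iR sub by simp
  \<comment> \<open>An annihilator of all of \<open>C\<close> kills the regular element
    \<open>c\<close>, so it is zero.\<close>
  have "\<one> \<ominus>\<^bsub>R_ring\<^esub> i = \<zero>" using reg[OF d] ann[OF c] m_comm[OF d C.Icarr[OF c]] by simp
  then have "\<one> = i" using R.r_right_minus_eq[of \<one> i] iR by simp
  then show False using i one(2) by simp
qed

theorem theorem3p2:
  fixes T :: "('a, 'b) ring_scheme" and R C :: "'a set"
  assumes "regular_conductor_square R T C"
    and "R \<noteq> carrier T"
    and "flat_module (T\<lparr>carrier := R\<rparr>) (ring_module T)"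
  shows "\<not> faithfully_flat_module (T\<lparr>carrier := R\<rparr> Quot C) (ring_module (T Quot C)) \<and>
    \<not> (\<exists>S. finite S \<and> S \<subseteq> C \<and> C = Idl\<^bsub>T\<lparr>carrier := R\<rparr>\<^esub> S)"
proof -
  interpret regular_conductor_square R T C by fact
  interpret C: ideal C T by (rule ideal_T)
  \<comment> \<open>Non-triviality supplies \<open>t\<close>. It makes \<open>?I\<close> proper,
    since one times \<open>t\<close> is not in \<open>R\<close>, while
    \<open>C t \<subseteq> C \<subseteq> R\<close> puts \<open>C\<close> inside
    \<open>?I\<close>.\<close>
  obtain t where t: "t \<in> carrier T" "t \<notin> R" using assms(2) subset by blast
  let ?I = "{r \<in> R. r \<otimes>\<^bsub>T\<^esub> t \<in> R}"
  have "C \<subseteq> ?I" using C_subset C.I_r_closed t(1) by blast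
  moreover have "\<one>\<^bsub>T\<^esub> \<notin> ?I" using t by simp
  ultimately show ?thesis
    using flat_imp_one_mem_genideal_colon[OF assms(3) t(1)] ideal_colon[OF t(1)]
      one_mem_genideal_imp_not_faithfully_flat one_mem_genideal_imp_not_finitely_generated by blast
qed

end
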